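(* Let $S\subseteq\mathbb R^n$ be a finite union of standard tentacles. Then the graded algebra $\mathcal B(S)=\bigoplus_{d\ge 0}\mathcal B_d(S)$ is a finitely generated $\mathbb R$-algebra.
   Context: Let $\mathbb R[x]=\mathbb R[x_1,\dots,x_n]$ and $\mathbb N=\{0,1,2,\dots\}$. For $S\subseteq\mathbb R^n$ and $d\in\mathbb N$ put $\mathcal B_d(S)=\{p\in\mathbb R[x] : \text{there is } q\in\mathbb R[x] \text{ with } \deg(q)\le 2d \text{ and } p^2\le q \text{ on } S\}$, where $\deg$ is the total degree. Each $\mathcal B_d(S)$ is a vector space, $\mathcal B_d(S)\cdot\mathcal B_{d'}(S)\subseteq\mathcal B_{d+d'}(S)$, and $\mathcal B(S)=\bigoplus_{d\ge0}\mathcal B_d(S)$ is the resulting graded algebra, identified with a subalgebra of $\mathbb R[x,t]$ by identifying $p\in\mathcal B_d(S)$ with $p\,t^d$. For $z=(z_1,\dots,z_n)\in\mathbb Z^n$, a standard $z$-tentacle is a set of the form $\{(\lambda^{z_1}b_1,\dots,\lambda^{z_n}b_n) : \lambda\ge 1,\ b\in B\}$, where $B\subseteq(\mathbb R\setminus\{0\})^n$ is a compact semialgebraic set with nonempty interior. A standard tentacle is a standard $z$-tentacle for some $z\in\mathbb Z^n$. *)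

theory Defs
  imports "HOL-Analysis.Analysis" "HOL-Library.Poly_Mapping"
    "HOL-Computational_Algebra.Polynomial"
begin

text \<open>
  The polynomial ring \<open>\<real>[x\<^sub>i : i \<in> 'n]\<close>: finitely supported maps from exponent vectors to
  coefficients, with the convolution product of \<^theory>\<open>HOL-Library.Poly_Mapping\<close>.
  The number of variables is \<open>CARD('n)\<close>.
\<close>

type_synonym 'n rpoly = "('n \<Rightarrow>\<^sub>0 nat) \<Rightarrow>\<^sub>0 real"

definition rpoly_const :: "real \<Rightarrow> 'n rpoly" where
  "rpoly_const c = Poly_Mapping.single 0 c"

definition rpoly_eval :: "'n::finite rpoly \<Rightarrow> real ^ 'n \<Rightarrow> real" where
  "rpoly_eval p x =
     (\<Sum>m\<in>Poly_Mapping.keys p.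
        Poly_Mapping.lookup p m * (\<Prod>i\<in>UNIV. (x $ i) ^ Poly_Mapping.lookup m i))"

text \<open>The zero polynomial gets total degree 0; only upper bounds on degrees are used.\<close>

definition total_degree :: "'n::finite rpoly \<Rightarrow> nat" where
  "total_degree p =
     Max (insert 0 ((\<lambda>m. \<Sum>i\<in>UNIV. Poly_Mapping.lookup m i) ` Poly_Mapping.keys p))"

inductive semialgebraic :: "(real ^ 'n::finite) set \<Rightarrow> bool" where
  positive: "semialgebraic {x. rpoly_eval p x > 0}"
| complement: "semialgebraic A \<Longrightarrow> semialgebraic (- A)"
| intersection: "semialgebraic A \<Longrightarrow> semialgebraic B \<Longrightarrow> semialgebraic (A \<inter> B)"
| union: "semialgebraic A \<Longrightarrow> semialgebraic B \<Longrightarrow> semialgebraic (A \<union> B)"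

definition standard_z_tentacle :: "int ^ 'n \<Rightarrow> (real ^ 'n::finite) set \<Rightarrow> bool" where
  "standard_z_tentacle z T \<longleftrightarrow>
     (\<exists>B. compact B \<and> semialgebraic B \<and> interior B \<noteq> {} \<and>
          (\<forall>b\<in>B. \<forall>i. b $ i \<noteq> 0) \<and>
          T = {(\<chi> i. (l powi (z $ i)) * b $ i) | l b. l \<ge> 1 \<and> b \<in> B})"

definition standard_tentacle :: "(real ^ 'n::finite) set \<Rightarrow> bool" where
  "standard_tentacle T \<longleftrightarrow> (\<exists>z. standard_z_tentacle z T)"

definition B_deg :: "nat \<Rightarrow> (real ^ 'n::finite) set \<Rightarrow> 'n rpoly set" where
  "B_deg d S =
     {p. \<exists>q. total_degree q \<le> 2 * d \<and> (\<forall>x\<in>S. (rpoly_eval p x)\<^sup>2 \<le> rpoly_eval q x)}"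

text \<open>
  The direct sum of the \<open>B_deg d S\<close>, realised inside \<open>\<real>[x,t]\<close> with \<open>p \<in> B_deg d S\<close> placed as
  \<open>p t\<^sup>d\<close>. Here \<open>\<real>[x,t]\<close> is taken as \<open>\<real>[x][t]\<close>, so the component of degree \<open>d\<close> is the
  coefficient of \<open>t\<^sup>d\<close>; the grading is by the power of \<open>t\<close>, not by total degree.
\<close>

definition B_graded :: "(real ^ 'n::finite) set \<Rightarrow> 'n rpoly poly set" where
  "B_graded S = {P. \<forall>d. coeff P d \<in> B_deg d S}"

text \<open>
  Unital \<open>\<real>\<close>-subalgebras of \<open>\<real>[x,t]\<close>. The scalars of \<^typ>\<open>'n rpoly poly\<close> seen as an
  \<open>\<real>\<close>-algebra are only the real constants, not all coefficients in \<open>\<real>[x]\<close>.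
\<close>

definition real_subalgebra :: "'n rpoly poly set \<Rightarrow> bool" where
  "real_subalgebra A \<longleftrightarrow>
     1 \<in> A \<and>
     (\<forall>f\<in>A. \<forall>g\<in>A. f + g \<in> A) \<and>
     (\<forall>f\<in>A. \<forall>g\<in>A. f * g \<in> A) \<and>
     (\<forall>c. \<forall>f\<in>A. smult (rpoly_const c) f \<in> A)"

text \<open>\<open>real_subalgebra hull G\<close> is the smallest subalgebra containing \<open>G\<close>.\<close>

definition finitely_generated_real_algebra :: "'n rpoly poly set \<Rightarrow> bool" where
  "finitely_generated_real_algebra A \<longleftrightarrow>
     (\<exists>G. finite G \<and> A = real_subalgebra hull G)"

end

theory Submission
  imports Defs
begin

text \<open>
  On a \<open>z\<close>-tentacle a polynomial of total degree at most \<open>2d\<close> grows at most like \<open>\<lambda>\<^bsup>2dM\<^esup>\<close> with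
  \<open>M = max(0, z\<^sub>1, \<dots>, z\<^sub>n)\<close>, and \<open>1 + \<Sum>\<^sub>i x\<^sub>i\<^bsup>2d\<^esup>\<close> attains this growth because the coordinates
  of the compact base are bounded away from \<open>0\<close>. The leading form of \<open>p\<close> with respect to \<open>z\<close> does
  not vanish identically on the interior of the base, so \<open>p \<in> B\<^sub>d(S)\<close> holds iff every exponent \<open>m\<close>
  of \<open>p\<close> satisfies \<open>\<langle>z, m\<rangle> \<le> dM\<close> for each of the tentacles. Hence \<open>B(S)\<close> is the algebra of the
  monoid of integer points \<open>(m, d)\<close> of a rational cone, and this monoid is finitely generated by
  Gordan's lemma.
\<close>

section \<open>Gordan's lemma\<close>

text \<open>The subsequence is thinned once for each function in \<open>F\<close>. A sequence of
  naturals has a monotone subsequence, and a decreasing one is eventually constant, so it can always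
  be made increasing; further thinning keeps the monotonicity already reached.\<close>

lemma dickson_subseq:
  fixes F :: "('a \<Rightarrow> nat) set" and s :: "nat \<Rightarrow> 'a"
  assumes "finite F"
  shows "\<exists>r. strict_mono r \<and> (\<forall>f\<in>F. incseq (\<lambda>k. f (s (r k))))"
  using assms
proof (induction F rule: finite_induct)
  case empty
  show ?case by (rule exI[of _ id]) (simp add: strict_mono_def)
next
  case (insert f F)
  then obtain r where r: "strict_mono r" "\<And>g. g \<in> F \<Longrightarrow> incseq (\<lambda>k. g (s (r k)))"
    by blast
  obtain u where u: "strict_mono u" "monoseq (\<lambda>k. f (s (r (u k))))"
    using seq_monosub[of "\<lambda>k. f (s (r k))"] by auto
  have "\<exists>v. strict_mono v \<and> incseq (\<lambda>k. f (s (r (u (v k)))))"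
  proof (cases "incseq (\<lambda>k. f (s (r (u k))))")
    case True
    then show ?thesis by (intro exI[of _ id]) (simp add: strict_mono_def)
  next
    case False
    define h where "h = (\<lambda>k. f (s (r (u k))))"
    have dec: "decseq h"
      using u(2) False by (simp add: monoseq_iff h_def)
    \<comment> \<open>\<open>h\<close> attains its minimum at \<open>k0\<close>; being decreasing,
      it is constant from there on.\<close>
    define k0 where "k0 = (ARG_MIN h k. True)"
    have "h k0 \<le> h k" for k
      unfolding k0_def by (rule arg_min_nat_le) simp
    then have "h (k0 + k) = h k0" for k
      using dec by (simp add: decseq_def le_antisym)
    then have "incseq (\<lambda>k. h (k0 + k))" by (simp add: incseq_def)
    then show ?thesis
      by (intro exI[of _ "\<lambda>k. k0 + k"]) (simp add: strict_mono_def h_def)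
  qed
  then obtain v where v: "strict_mono v" "incseq (\<lambda>k. f (s (r (u (v k)))))" by blast
  have uv: "strict_mono (u \<circ> v)" using u(1) v(1) by (rule strict_mono_o)
  have "incseq (\<lambda>k. g (s (r (u (v k)))))" if "g \<in> F" for g
    using r(2)[OF that] uv unfolding incseq_def
    by (metis comp_apply monoD strict_mono_mono)
  moreover have "strict_mono (r \<circ> (u \<circ> v))" using r(1) uv by (rule strict_mono_o)
  ultimately show ?case using v(2) by (intro exI[of _ "r \<circ> (u \<circ> v)"]) (simp add: o_def)
qed

text \<open>Dickson's lemma: an injective sequence in an infinite \<open>A\<close> would have a
  subsequence along which all of \<open>F\<close> increases, hence two distinct comparable
  terms.\<close>

lemma finite_if_antichain:
  fixes F :: "('a \<Rightarrow> nat) set"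
  assumes "finite F"
    and antichain: "\<And>x y. x \<in> A \<Longrightarrow> y \<in> A \<Longrightarrow> (\<forall>f\<in>F. f x \<le> f y) \<Longrightarrow> x = y"
  shows "finite A"
proof (rule ccontr)
  assume "infinite A"
  then obtain s :: "nat \<Rightarrow> 'a" where s: "inj s" "range s \<subseteq> A"
    using infinite_countable_subset by blast
  obtain r where r: "strict_mono r" "\<forall>f\<in>F. incseq (\<lambda>k. f (s (r k)))"
    using dickson_subseq[OF \<open>finite F\<close>] by blast
  have "s (r 0) = s (r 1)"
    using r(2) s(2) by (intro antichain) (auto simp: incseq_def)
  then have "r 0 = r 1" using s(1) by (simp add: inj_eq)
  with r(1) show False by (simp add: strict_mono_eq)
qed

text \<open>Gordan's argument in abstract form. By \<open>diff\<close>, comparability under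
  \<open>F\<close> implies divisibility in \<open>M\<close>, so the indecomposable elements form an
  antichain; descent on \<open>size\<close> writes every element as a sum of them. Generation is
  phrased through an arbitrary \<open>H\<close> so that \<open>H\<close> can later be a preimage of
  a subalgebra.\<close>

lemma finitely_generated_monoid:
  fixes M :: "'a::comm_monoid_add set" and F :: "('a \<Rightarrow> nat) set" and size :: "'a \<Rightarrow> nat"
  assumes "finite F"
    and diff: "\<And>x y. x \<in> M \<Longrightarrow> y \<in> M \<Longrightarrow> (\<forall>f\<in>F. f x \<le> f y) \<Longrightarrow> \<exists>w\<in>M. y = x + w"
    and size_add: "\<And>x y. size (x + y) = size x + size y"
    and size_pos: "\<And>x. x \<noteq> 0 \<Longrightarrow> size x > 0"
  shows "\<exists>G\<subseteq>M. finite G \<and>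
    (\<forall>H. G \<subseteq> H \<longrightarrow> 0 \<in> H \<longrightarrow> (\<forall>x\<in>H. \<forall>y\<in>H. x + y \<in> H) \<longrightarrow> M \<subseteq> H)"
proof -
  \<comment> \<open>The indecomposable elements of \<open>M\<close>, that is, its Hilbert
    basis.\<close>
  define G where
    "G = {x \<in> M. x \<noteq> 0 \<and> (\<forall>u\<in>M. \<forall>w\<in>M. x = u + w \<longrightarrow> u = 0 \<or> w = 0)}"
  have "finite G"
    using \<open>finite F\<close>
  proof (rule finite_if_antichain)
    fix x y assume xy: "x \<in> G" "y \<in> G" "\<forall>f\<in>F. f x \<le> f y"
    then have "\<exists>w\<in>M. y = x + w" by (intro diff) (auto simp: G_def)
    then obtain w where "w \<in> M" "y = x + w" by blast
    with xy have "w = 0" by (auto simp: G_def)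
    with \<open>y = x + w\<close> show "x = y" by simp
  qed
  moreover have "M \<subseteq> H"
    if H: "G \<subseteq> H" "0 \<in> H" "\<forall>x\<in>H. \<forall>y\<in>H. x + y \<in> H" for H
  proof
    fix x assume "x \<in> M"
    then show "x \<in> H"
    proof (induction "size x" arbitrary: x rule: less_induct)
      case less
      consider "x = 0" | "x \<in> G" | u w where "u \<in> M" "w \<in> M" "x = u + w" "u \<noteq> 0" "w \<noteq> 0"
        using less.prems by (auto simp: G_def)
      then show ?case
      proof cases
        case 3
        \<comment> \<open>Both summands are nonzero, so each has positive size and the other is
          strictly smaller than \<open>x\<close>.\<close>
        then have "size u < size x" "size w < size x"
          using size_pos by (auto simp: size_add)
        with less.hyps 3 H(3) show ?thesis by blast
      qed (use H in auto)
    qed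
  qed
  ultimately show ?thesis by (intro exI[of _ G]) (auto simp: G_def)
qed

section \<open>Monomials and weights\<close>

definition monom_eval :: "('n::finite \<Rightarrow>\<^sub>0 nat) \<Rightarrow> real ^ 'n \<Rightarrow> real" where
  "monom_eval m x = (\<Prod>i\<in>UNIV. (x $ i) ^ Poly_Mapping.lookup m i)"

text \<open>The exponent of \<lambda> that the monomial with exponent vector \<open>m\<close> picks
  up along a \<open>z\<close>-tentacle.\<close>

definition weight :: "int ^ 'n \<Rightarrow> ('n::finite \<Rightarrow>\<^sub>0 nat) \<Rightarrow> int" where
  "weight z m = (\<Sum>i\<in>UNIV. z $ i * int (Poly_Mapping.lookup m i))"

text \<open>The largest weight of a monomial of degree at most 1. The inserted 0 is the weight of
  the constant monomial and matters when all entries of \<open>z\<close> are negative.\<close>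

definition weight_bound :: "int ^ 'n::finite \<Rightarrow> int" where
  "weight_bound z = Max (insert 0 (range (($) z)))"

text \<open>A pair \<open>(m, d)\<close> stands for the monomial x^m t^d.\<close>

definition weight_cone :: "(int ^ 'n::finite) set \<Rightarrow> (('n \<Rightarrow>\<^sub>0 nat) \<times> nat) set" where
  "weight_cone Z = {(m, d). \<forall>z\<in>Z. weight z m \<le> int d * weight_bound z}"

definition scale :: "int ^ 'n \<Rightarrow> real \<Rightarrow> real ^ 'n \<Rightarrow> real ^ 'n" where
  "scale z l b = (\<chi> i. (l powi (z $ i)) * b $ i)"

lemma weight_add: "weight z (m + m') = weight z m + weight z m'"
  by (simp add: weight_def lookup_add algebra_simps sum.distrib)

lemma weight_zero [simp]: "weight z 0 = 0"
  by (simp add: weight_def)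

lemma weight_bound_nonneg: "0 \<le> weight_bound z"
  by (simp add: weight_bound_def)

lemma weight_bound_ge: "z $ i \<le> weight_bound z"
  unfolding weight_bound_def by (rule Max_ge) auto

lemma weight_bound_cases: "weight_bound z = 0 \<or> (\<exists>i. weight_bound z = z $ i)"
proof -
  have "weight_bound z \<in> insert 0 (range (($) z))"
    unfolding weight_bound_def by (rule Max_in) auto
  then show ?thesis by auto
qed

lemma weight_le_total_degree:
  assumes "total_degree q \<le> k" "m \<in> Poly_Mapping.keys q"
  shows "weight z m \<le> int k * weight_bound z"
proof -
  have "(\<Sum>i\<in>UNIV. Poly_Mapping.lookup m i) \<le> total_degree q"
    unfolding total_degree_def using assms(2) by (intro Max_ge) auto
  then have "(\<Sum>i\<in>UNIV. Poly_Mapping.lookup m i) \<le> k"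
    using assms(1) by linarith
  then have le: "(\<Sum>i\<in>UNIV. int (Poly_Mapping.lookup m i)) \<le> int k"
    by (metis of_nat_le_iff of_nat_sum)
  have "weight z m \<le> (\<Sum>i\<in>UNIV. weight_bound z * int (Poly_Mapping.lookup m i))"
    unfolding weight_def by (intro sum_mono mult_right_mono weight_bound_ge) simp
  also have "\<dots> = weight_bound z * (\<Sum>i\<in>UNIV. int (Poly_Mapping.lookup m i))"
    by (simp add: sum_distrib_left)
  also have "\<dots> \<le> weight_bound z * int k"
    by (intro mult_left_mono le weight_bound_nonneg)
  finally show ?thesis by (simp add: mult.commute)
qed

section \<open>Evaluation of monomials and polynomials\<close>

lemma monom_eval_scale:
  assumes "l \<noteq> 0"
  shows "monom_eval m (scale z l b) = l powi weight z m * monom_eval m b"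
proof -
  have "l powi (\<Sum>i\<in>I. f i) = (\<Prod>i\<in>I. l powi f i)" for I and f :: "'a \<Rightarrow> int"
    using assms by (induction I rule: infinite_finite_induct) (auto simp: power_int_add)
  then show ?thesis
    by (simp add: monom_eval_def scale_def weight_def power_mult_distrib prod.distrib
        power_int_power')
qed

text \<open>Allows a common index set for several polynomials, since the keys of a sum may shrink by
  cancellation.\<close>

lemma rpoly_eval_superset:
  assumes "finite K" "Poly_Mapping.keys p \<subseteq> K"
  shows "rpoly_eval p x = (\<Sum>m\<in>K. Poly_Mapping.lookup p m * monom_eval m x)"
  unfolding rpoly_eval_def monom_eval_def using assms
  by (intro sum.mono_neutral_left) (auto simp: in_keys_iff)

lemma rpoly_eval_monom_eval:
  "rpoly_eval p x = (\<Sum>m\<in>Poly_Mapping.keys p. Poly_Mapping.lookup p m * monom_eval m x)"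
  by (rule rpoly_eval_superset) auto

lemma rpoly_eval_add: "rpoly_eval (p + q) x = rpoly_eval p x + rpoly_eval q x"
proof -
  let ?K = "Poly_Mapping.keys p \<union> Poly_Mapping.keys q"
  have "Poly_Mapping.keys (p + q) \<subseteq> ?K" by (rule keys_add)
  then show ?thesis
    by (simp add: rpoly_eval_superset[of ?K] lookup_add algebra_simps sum.distrib)
qed

lemma rpoly_eval_sum: "finite I \<Longrightarrow> rpoly_eval (\<Sum>i\<in>I. p i) x = (\<Sum>i\<in>I. rpoly_eval (p i) x)"
  by (induction I rule: finite_induct) (simp_all add: rpoly_eval_add, simp add: rpoly_eval_def)

lemma rpoly_eval_single: "rpoly_eval (Poly_Mapping.single m c) x = c * monom_eval m x"
  by (subst rpoly_eval_superset[of "{m}"]) auto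

lemma monom_eval_single: "monom_eval (Poly_Mapping.single i k) x = (x $ i) ^ k"
proof -
  have "monom_eval (Poly_Mapping.single i k) x = (\<Prod>j\<in>UNIV. if j = i then (x $ i) ^ k else 1)"
    unfolding monom_eval_def by (intro prod.cong) (auto simp: lookup_single when_def)
  then show ?thesis by simp
qed

lemma monom_eval_zero [simp]: "monom_eval 0 x = 1"
  by (simp add: monom_eval_def)

lemma continuous_on_monom_eval: "continuous_on A (monom_eval m)"
  unfolding monom_eval_def by (intro continuous_intros)

section \<open>Polynomials on open sets\<close>

text \<open>Finitely many hyperplanes do not cover the lattice points of the orthant. If the
  \<open>w\<close> found for \<open>V\<close> is orthogonal to the new vector \<open>v\<close>, a
  large multiple of \<open>w\<close> is perturbed by a unit vector \<open>j\<close> with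
  \<open>v j \<noteq> 0\<close>.\<close>

lemma generic_weight:
  fixes V :: "('n::finite \<Rightarrow> int) set"
  assumes "finite V" "(\<lambda>_. 0) \<notin> V"
  shows "\<exists>w :: 'n \<Rightarrow> nat. \<forall>v\<in>V. (\<Sum>i\<in>UNIV. int (w i) * v i) \<noteq> 0"
  using assms
proof (induction V rule: finite_induct)
  case (insert v V)
  then obtain w :: "'n \<Rightarrow> nat" where w: "\<And>v. v \<in> V \<Longrightarrow> (\<Sum>i\<in>UNIV. int (w i) * v i) \<noteq> 0"
    by auto
  show ?case
  proof (cases "(\<Sum>i\<in>UNIV. int (w i) * v i) = 0")
    case False
    with w show ?thesis by blast
  next
    case True
    obtain j where j: "v j \<noteq> 0" using insert.prems by (metis ext insertI1)
    \<comment> \<open>\<open>N\<close> exceeds every \<open>\<bar>u j\<bar>\<close> with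
      \<open>u \<in> V\<close>, so the perturbation \<open>u j\<close> cannot cancel a nonzero
      multiple of \<open>N\<close>.\<close>
    define N where "N = Suc (\<Sum>u\<in>V. nat \<bar>u j\<bar>)"
    define w' where "w' i = N * w i + (if i = j then 1 else 0)" for i
    have eq: "(\<Sum>i\<in>UNIV. int (w' i) * u i) = int N * (\<Sum>i\<in>UNIV. int (w i) * u i) + u j" for u
    proof -
      have "int (w' i) * u i = int N * (int (w i) * u i) + (if i = j then u j else 0)" for i
        by (simp add: w'_def algebra_simps)
      then show ?thesis by (simp add: sum.distrib sum_distrib_left)
    qed
    have "(\<Sum>i\<in>UNIV. int (w' i) * u i) \<noteq> 0" if "u \<in> V" for u
    proof
      assume "(\<Sum>i\<in>UNIV. int (w' i) * u i) = 0"
      then have *: "u j = int N * - (\<Sum>i\<in>UNIV. int (w i) * u i)"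
        unfolding eq by simp
      have "nat \<bar>u j\<bar> \<le> (\<Sum>u\<in>V. nat \<bar>u j\<bar>)"
        using that insert.hyps(1) by (intro member_le_sum) auto
      then have less: "\<bar>u j\<bar> < int N" unfolding N_def by linarith
      have "1 \<le> \<bar>- (\<Sum>i\<in>UNIV. int (w i) * u i)\<bar>" using w[OF that] by linarith
      then have "int N * 1 \<le> int N * \<bar>- (\<Sum>i\<in>UNIV. int (w i) * u i)\<bar>"
        by (intro mult_left_mono) auto
      also have "\<dots> = \<bar>u j\<bar>" unfolding * abs_mult by simp
      finally show False using less by simp
    qed
    moreover have "(\<Sum>i\<in>UNIV. int (w' i) * v i) \<noteq> 0" using eq[of v] True j by simp
    ultimately show ?thesis by blast
  qed
qed simp

text \<open>A weight separates two exponents iff it is not orthogonal to their difference, so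
  \<open>generic_weight\<close> applies to the nonzero differences. Natural weights are wanted
  because they become powers of a curve parameter.\<close>

lemma separating_weight:
  fixes K :: "('n::finite \<Rightarrow>\<^sub>0 nat) set"
  assumes "finite K"
  shows "\<exists>w :: 'n \<Rightarrow> nat. inj_on (\<lambda>m. \<Sum>i\<in>UNIV. w i * Poly_Mapping.lookup m i) K"
proof -
  define D :: "('n \<Rightarrow>\<^sub>0 nat) \<times> ('n \<Rightarrow>\<^sub>0 nat) \<Rightarrow> 'n \<Rightarrow> int"
    where "D = (\<lambda>(m, m') i. int (Poly_Mapping.lookup m i) - int (Poly_Mapping.lookup m' i))"
  have "finite (D ` (K \<times> K) - {\<lambda>_. 0})" using assms by auto
  then obtain w :: "'n \<Rightarrow> nat" where
    w: "\<And>v. v \<in> D ` (K \<times> K) - {\<lambda>_. 0} \<Longrightarrow> (\<Sum>i\<in>UNIV. int (w i) * v i) \<noteq> 0"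
    using generic_weight[of "D ` (K \<times> K) - {\<lambda>_. 0}"] by blast
  have "inj_on (\<lambda>m. \<Sum>i\<in>UNIV. w i * Poly_Mapping.lookup m i) K"
  proof (rule inj_onI, rule ccontr)
    fix m m' assume m: "m \<in> K" "m' \<in> K" "m \<noteq> m'"
      and eq: "(\<Sum>i\<in>UNIV. w i * Poly_Mapping.lookup m i) = (\<Sum>i\<in>UNIV. w i * Poly_Mapping.lookup m' i)"
    have "D (m, m') \<noteq> (\<lambda>_. 0)"
      using m(3) by (auto simp: D_def fun_eq_iff poly_mapping_eq_iff)
    then have "(\<Sum>i\<in>UNIV. int (w i) * D (m, m') i) \<noteq> 0" using m by (intro w) blast
    moreover have "(\<Sum>i\<in>UNIV. int (w i) * D (m, m') i) =
        int (\<Sum>i\<in>UNIV. w i * Poly_Mapping.lookup m i) - int (\<Sum>i\<in>UNIV. w i * Poly_Mapping.lookup m' i)"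
      by (simp add: D_def algebra_simps sum_subtractf)
    ultimately show False using eq by simp
  qed
  then show ?thesis by blast
qed

text \<open>
  Along the curve \<open>s \<mapsto> (s\<^bsup>w i\<^esup> b\<^sub>i)\<^sub>i\<close> with \<open>w\<close> separating the exponents, the monomials become
  distinct powers of \<open>s\<close>, which reduces the claim to the finiteness of the roots of a univariate
  polynomial.
\<close>

lemma monomials_independent_on_open:
  fixes U :: "(real ^ 'n::finite) set"
  assumes "open U" "b \<in> U" "\<And>i. b $ i \<noteq> 0"
    and "finite K" "K \<noteq> {}" "\<And>m. m \<in> K \<Longrightarrow> c m \<noteq> 0"
  shows "\<exists>x\<in>U. (\<Sum>m\<in>K. c m * monom_eval m x) \<noteq> 0"
proof -
  obtain w :: "'n \<Rightarrow> nat"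
    where w: "inj_on (\<lambda>m. \<Sum>i\<in>UNIV. w i * Poly_Mapping.lookup m i) K"
    using separating_weight[OF \<open>finite K\<close>] by blast
  define e where "e m = (\<Sum>i\<in>UNIV. w i * Poly_Mapping.lookup m i)" for m :: "'n \<Rightarrow>\<^sub>0 nat"
  define g where "g s = (\<chi> i. s ^ w i * b $ i)" for s :: real
  define f where "f = (\<Sum>m\<in>K. Polynomial.monom (c m * monom_eval m b) (e m))"
  have poly_f: "poly f s = (\<Sum>m\<in>K. c m * monom_eval m (g s))" for s
  proof -
    have "monom_eval m (g s) = s ^ e m * monom_eval m b" for m
      by (simp add: monom_eval_def g_def e_def power_mult_distrib prod.distrib power_sum
          flip: power_mult)
    then show ?thesis by (simp add: f_def poly_sum poly_monom algebra_simps)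
  qed
  obtain m0 where m0: "m0 \<in> K" using \<open>K \<noteq> {}\<close> by blast
  \<comment> \<open>Since \<open>e\<close> is injective on \<open>K\<close>, no other monomial
    contributes to this coefficient.\<close>
  have "coeff f (e m0) = (\<Sum>m\<in>K. if m = m0 then c m * monom_eval m b else 0)"
    unfolding f_def coeff_sum
    using w m0 by (intro sum.cong) (auto simp: inj_on_def e_def)
  also have "\<dots> = c m0 * monom_eval m0 b" using \<open>finite K\<close> m0 by simp
  also have "\<dots> \<noteq> 0" using assms(3,6) m0 by (simp add: monom_eval_def)
  finally have "f \<noteq> 0" by auto
  then have fin: "finite {s. poly f s = 0}" by (rule poly_roots_finite)
  \<comment> \<open>The curve passes through \<open>b\<close> at parameter 1, so it stays in
    \<open>U\<close> for infinitely many parameters, and some of them is not a root of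
    \<open>f\<close>.\<close>
  have "open (g -` U)"
    using \<open>open U\<close> unfolding g_def by (intro open_vimage continuous_intros)
  moreover have "1 \<in> g -` U" using \<open>b \<in> U\<close> by (simp add: g_def)
  ultimately have "infinite (g -` U)"
    by (metis empty_iff finite_imp_not_open)
  then obtain s where "s \<in> g -` U" "poly f s \<noteq> 0"
    using fin by (metis (mono_tags) mem_Collect_eq finite_subset subsetI)
  then show ?thesis using poly_f by auto
qed

section \<open>Growth on tentacles\<close>

lemma tendsto_powi_neg:
  assumes "k < 0"
  shows "((\<lambda>l::real. l powi k) \<longlongrightarrow> 0) at_top"
proof -
  have "((\<lambda>l::real. inverse (l ^ nat (- k))) \<longlongrightarrow> 0) at_top"
    using assms
    by (intro tendsto_inverse_0_at_top filterlim_pow_at_top filterlim_ident) auto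
  then show ?thesis using assms by (simp add: power_int_def power_inverse)
qed

text \<open>After division by \<open>l powi e\<close> the terms of lower exponent tend to 0 and the
  sum tends to the sum of the top coefficients, while its square is at most a constant times
  \<open>l powi (2 * D - 2 * e)\<close>, which tends to 0.\<close>

lemma growth_coeff_zero:
  fixes a :: "'a \<Rightarrow> real" and k :: "'a \<Rightarrow> int"
  assumes "finite K"
    and bound: "\<And>l. l \<ge> 1 \<Longrightarrow> (\<Sum>m\<in>K. a m * l powi k m)\<^sup>2 \<le> C * l powi (2 * D)"
    and top: "\<And>m. m \<in> K \<Longrightarrow> k m \<le> e" and "D < e"
  shows "(\<Sum>m | m \<in> K \<and> k m = e. a m) = 0"
proof -
  let ?f = "\<lambda>l. \<Sum>m\<in>K. a m * l powi (k m - e)"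
  have "((\<lambda>l. a m * l powi (k m - e)) \<longlongrightarrow> (if k m = e then a m else 0)) at_top" if "m \<in> K" for m
  proof (cases "k m = e")
    case False
    then have "k m - e < 0" using top[OF that] by simp
    from tendsto_mult_right_zero[OF tendsto_powi_neg[OF this]] False show ?thesis by simp
  qed simp
  then have "(?f \<longlongrightarrow> (\<Sum>m\<in>K. if k m = e then a m else 0)) at_top"
    by (intro tendsto_sum)
  also have "(\<Sum>m\<in>K. if k m = e then a m else 0) = (\<Sum>m | m \<in> K \<and> k m = e. a m)"
    using \<open>finite K\<close> by (simp add: sum.inter_filter)
  finally have lim: "((\<lambda>l. (?f l)\<^sup>2) \<longlongrightarrow> (\<Sum>m | m \<in> K \<and> k m = e. a m)\<^sup>2) at_top"
    by (rule tendsto_power)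
  have upper: "((\<lambda>l::real. C * l powi (2 * D - 2 * e)) \<longlongrightarrow> 0) at_top"
    using \<open>D < e\<close> by (intro tendsto_mult_right_zero tendsto_powi_neg) simp
  have "((\<lambda>l. (?f l)\<^sup>2) \<longlongrightarrow> 0) at_top"
  proof (rule tendsto_sandwich[OF _ _ tendsto_const upper])
    have "(?f l)\<^sup>2 \<le> C * l powi (2 * D - 2 * e)" if "l \<ge> 1" for l
    proof -
      have "?f l = (\<Sum>m\<in>K. a m * l powi k m) * l powi (- e)"
        unfolding sum_distrib_right using that
        by (intro sum.cong) (auto simp: power_int_diff power_int_minus field_simps)
      then have "(?f l)\<^sup>2 = (\<Sum>m\<in>K. a m * l powi k m)\<^sup>2 * (l powi (- e))\<^sup>2"
        by (simp add: power_mult_distrib)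
      also have "\<dots> \<le> C * l powi (2 * D) * (l powi (- e))\<^sup>2"
        using bound[OF that] by (intro mult_right_mono) auto
      also have "\<dots> = C * l powi (2 * D - 2 * e)"
      proof -
        have "l powi (2 * D - 2 * e) = l powi (2 * D + (- e) * int 2)" by (simp add: mult.commute)
        also have "\<dots> = l powi (2 * D) * (l powi (- e))\<^sup>2"
          unfolding power_int_power' using that by (intro power_int_add) simp
        finally show ?thesis by (simp only: mult.assoc)
      qed
      finally show ?thesis .
    qed
    then show "\<forall>\<^sub>F l in at_top. (?f l)\<^sup>2 \<le> C * l powi (2 * D - 2 * e)"
      by (rule eventually_at_top_linorderI)
  qed simp
  with lim have "(\<Sum>m | m \<in> K \<and> k m = e. a m)\<^sup>2 = 0"
    by (intro tendsto_unique[OF trivial_limit_at_top_linorder])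
  then show ?thesis by simp
qed

text \<open>If the top weight \<open>e\<close> of \<open>p\<close> exceeded the bound,
  \<open>growth_coeff_zero\<close> along the curve through a base point \<open>b\<close> would make
  the leading form of \<open>p\<close> vanish at \<open>b\<close>; but \<open>b\<close> is chosen
  where it does not vanish.\<close>

lemma weight_le_if_dominated:
  fixes T :: "(real ^ 'n::finite) set"
  assumes T: "standard_z_tentacle z T"
    and deg: "total_degree q \<le> 2 * d"
    and dom: "\<And>x. x \<in> T \<Longrightarrow> (rpoly_eval p x)\<^sup>2 \<le> rpoly_eval q x"
    and m: "m \<in> Poly_Mapping.keys p"
  shows "weight z m \<le> int d * weight_bound z"
proof (rule ccontr)
  assume neg: "\<not> ?thesis"
  obtain B where B: "interior B \<noteq> {}" "\<And>b i. b \<in> B \<Longrightarrow> b $ i \<noteq> 0"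
    "T = {scale z l b | l b. l \<ge> 1 \<and> b \<in> B}"
    using T unfolding standard_z_tentacle_def scale_def by blast
  define e where "e = Max (weight z ` Poly_Mapping.keys p)"
  define K where "K = {m \<in> Poly_Mapping.keys p. weight z m = e}"
  have le_e: "weight z m' \<le> e" if "m' \<in> Poly_Mapping.keys p" for m'
    using that by (simp add: e_def)
  have "e \<in> weight z ` Poly_Mapping.keys p"
    unfolding e_def using m by (intro Max_in) auto
  then have "K \<noteq> {}" by (auto simp: K_def)
  have e_gt: "int d * weight_bound z < e" using neg le_e[OF m] by simp
  obtain b0 where b0: "b0 \<in> interior B" using B(1) by blast
  then have "b0 \<in> B" using interior_subset by blast
  \<comment> \<open>The sum over \<open>K\<close> is the leading form of \<open>p\<close>; the
    nonempty interior of the base provides the open set.\<close>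
  have "\<exists>b\<in>interior B. (\<Sum>m\<in>K. Poly_Mapping.lookup p m * monom_eval m b) \<noteq> 0"
    using B(2)[OF \<open>b0 \<in> B\<close>] b0 \<open>K \<noteq> {}\<close>
    by (intro monomials_independent_on_open) (auto simp: K_def in_keys_iff)
  then obtain b where b: "b \<in> B" "(\<Sum>m\<in>K. Poly_Mapping.lookup p m * monom_eval m b) \<noteq> 0"
    using interior_subset by blast
  \<comment> \<open>Bounds the coefficients of \<open>q\<close> along the single curve
    \<open>l \<mapsto> scale z l b\<close>.\<close>
  define C where "C = (\<Sum>m\<in>Poly_Mapping.keys q. \<bar>Poly_Mapping.lookup q m * monom_eval m b\<bar>)"
  have bound: "(\<Sum>m\<in>Poly_Mapping.keys p. Poly_Mapping.lookup p m * monom_eval m b * l powi weight z m)\<^sup>2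
      \<le> C * l powi (2 * (int d * weight_bound z))" if "l \<ge> 1" for l :: real
  proof -
    have "(\<Sum>m\<in>Poly_Mapping.keys p. Poly_Mapping.lookup p m * monom_eval m b * l powi weight z m)
        = rpoly_eval p (scale z l b)"
      using that by (simp add: rpoly_eval_monom_eval monom_eval_scale mult_ac)
    moreover have "(rpoly_eval p (scale z l b))\<^sup>2 \<le> rpoly_eval q (scale z l b)"
      using that b(1) B(3) by (intro dom) blast
    moreover have "rpoly_eval q (scale z l b) \<le> C * l powi (2 * (int d * weight_bound z))"
    proof -
      have "Poly_Mapping.lookup q m * monom_eval m (scale z l b)
          \<le> \<bar>Poly_Mapping.lookup q m * monom_eval m b\<bar> * l powi (2 * (int d * weight_bound z))"
        if "m \<in> Poly_Mapping.keys q" for m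
      proof -
        have "weight z m \<le> 2 * (int d * weight_bound z)"
          using weight_le_total_degree[OF deg that, of z] by simp
        then have "l powi weight z m \<le> l powi (2 * (int d * weight_bound z))"
          using \<open>l \<ge> 1\<close> by (rule power_int_increasing)
        then have "\<bar>Poly_Mapping.lookup q m * monom_eval m b\<bar> * l powi weight z m
            \<le> \<bar>Poly_Mapping.lookup q m * monom_eval m b\<bar> * l powi (2 * (int d * weight_bound z))"
          by (intro mult_left_mono) auto
        moreover have "Poly_Mapping.lookup q m * monom_eval m (scale z l b)
          \<le> \<bar>Poly_Mapping.lookup q m * monom_eval m b\<bar> * l powi weight z m"
        proof -
          have "Poly_Mapping.lookup q m * monom_eval m (scale z l b)
            = Poly_Mapping.lookup q m * monom_eval m b * l powi weight z m"
            using \<open>l \<ge> 1\<close> by (simp add: monom_eval_scale)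
          also have "\<dots> \<le> \<bar>Poly_Mapping.lookup q m * monom_eval m b\<bar> * l powi weight z m"
            using \<open>l \<ge> 1\<close> by (intro mult_right_mono) auto
          finally show ?thesis .
        qed
        ultimately show ?thesis by linarith
      qed
      then show ?thesis unfolding rpoly_eval_monom_eval C_def sum_distrib_right
        by (rule sum_mono)
    qed
    ultimately show ?thesis by simp
  qed
  have "(\<Sum>m | m \<in> Poly_Mapping.keys p \<and> weight z m = e.
      Poly_Mapping.lookup p m * monom_eval m b) = 0"
    by (rule growth_coeff_zero[OF _ bound le_e e_gt]) simp_all
  with b(2) show False by (simp add: K_def)
qed

lemma continuous_on_compact_bdd_above:
  fixes f :: "'a::topological_space \<Rightarrow> real"
  assumes "compact B" "continuous_on B f"
  shows "\<exists>R. \<forall>b\<in>B. f b \<le> R"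
  using bounded_imp_bdd_above[OF compact_imp_bounded[OF compact_continuous_image[OF assms(2,1)]]]
  by (auto simp: bdd_above_def)

text \<open>Compactness bounds \<open>p\<close> squared by a constant times \<lambda>^(2dM), where M
  is \<open>weight_bound z\<close>, and the sum on the right grows at least that fast. The
  comparison polynomial is the same for every \<open>z\<close>, so that several tentacles can be
  treated together.\<close>

lemma dominated_if_weight_le:
  fixes T :: "(real ^ 'n::finite) set"
  assumes T: "standard_z_tentacle z T"
    and p: "\<And>m. m \<in> Poly_Mapping.keys p \<Longrightarrow> weight z m \<le> int d * weight_bound z"
  shows "\<exists>C\<ge>0. \<forall>x\<in>T. (rpoly_eval p x)\<^sup>2 \<le> C * (1 + (\<Sum>i\<in>UNIV. (x $ i) ^ (2 * d)))"
proof -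
  obtain B where B: "compact B" "\<And>b i. b \<in> B \<Longrightarrow> b $ i \<noteq> 0"
    "T = {scale z l b | l b. l \<ge> 1 \<and> b \<in> B}"
    using T unfolding standard_z_tentacle_def scale_def by blast
  let ?P = "\<lambda>b. \<Sum>m\<in>Poly_Mapping.keys p. \<bar>Poly_Mapping.lookup p m * monom_eval m b\<bar>"
  let ?D = "int d * weight_bound z"
  have "continuous_on B ?P"
    by (intro continuous_intros continuous_on_monom_eval)
  then obtain R where R: "\<And>b. b \<in> B \<Longrightarrow> ?P b \<le> R"
    using continuous_on_compact_bdd_above[OF B(1)] by blast
  have up: "(rpoly_eval p (scale z l b))\<^sup>2 \<le> R\<^sup>2 * l powi (2 * ?D)"
    if "l \<ge> 1" "b \<in> B" for l b
  proof -
    have "\<bar>rpoly_eval p (scale z l b)\<bar>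
      \<le> (\<Sum>m\<in>Poly_Mapping.keys p. \<bar>Poly_Mapping.lookup p m * monom_eval m (scale z l b)\<bar>)"
      unfolding rpoly_eval_monom_eval by (rule sum_abs)
    also have "\<dots> \<le> (\<Sum>m\<in>Poly_Mapping.keys p. \<bar>Poly_Mapping.lookup p m * monom_eval m b\<bar> * l powi ?D)"
    proof (rule sum_mono)
      fix m assume "m \<in> Poly_Mapping.keys p"
      then have "l powi weight z m \<le> l powi ?D"
        using that by (intro power_int_increasing p) auto
      then have "\<bar>Poly_Mapping.lookup p m * monom_eval m b\<bar> * l powi weight z m
          \<le> \<bar>Poly_Mapping.lookup p m * monom_eval m b\<bar> * l powi ?D"
        by (intro mult_left_mono) auto
      then show "\<bar>Poly_Mapping.lookup p m * monom_eval m (scale z l b)\<bar>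
          \<le> \<bar>Poly_Mapping.lookup p m * monom_eval m b\<bar> * l powi ?D"
        using that by (simp add: monom_eval_scale abs_mult mult_ac)
    qed
    also have "\<dots> = ?P b * l powi ?D" by (simp add: sum_distrib_right)
    also have "\<dots> \<le> R * l powi ?D"
      using R[OF that(2)] that(1) by (intro mult_right_mono) auto
    finally have "\<bar>rpoly_eval p (scale z l b)\<bar>\<^sup>2 \<le> (R * l powi ?D)\<^sup>2"
      by (intro power_mono) auto
    then show ?thesis by (simp add: power_mult_distrib power_int_power' mult_ac)
  qed
  have "\<exists>R'\<ge>0. \<forall>l b. l \<ge> 1 \<longrightarrow> b \<in> B \<longrightarrow>
    l powi (2 * ?D) \<le> R' * (1 + (\<Sum>i\<in>UNIV. (scale z l b $ i) ^ (2 * d)))"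
    \<comment> \<open>If the bound is 0, the summand 1 suffices; otherwise the coordinate
      \<open>i\<close> attaining the bound gives the growth.\<close>
    using weight_bound_cases[of z]
  proof (elim disjE exE)
    assume "weight_bound z = 0"
    then show ?thesis by (intro exI[of _ 1]) (simp add: sum_nonneg)
  next
    fix i assume i: "weight_bound z = z $ i"
    \<comment> \<open>Coordinates do not vanish on the compact base, so this inverse is continuous
      and bounded there.\<close>
    have "continuous_on B (\<lambda>b. inverse ((b $ i) ^ (2 * d)))"
      using B(2) by (intro continuous_intros) auto
    then obtain R' where R': "\<And>b. b \<in> B \<Longrightarrow> inverse ((b $ i) ^ (2 * d)) \<le> R'"
      using continuous_on_compact_bdd_above[OF B(1)] by blast
    \<comment> \<open>\<open>max 0\<close> makes the constant nonnegative; the bounds over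
      \<open>B\<close> alone give this only for nonempty \<open>B\<close>.\<close>
    have "l powi (2 * ?D) \<le> max 0 R' * (1 + (\<Sum>i\<in>UNIV. (scale z l b $ i) ^ (2 * d)))"
      if "l \<ge> 1" "b \<in> B" for l b
    proof -
      have "(scale z l b $ i) ^ (2 * d) = l powi (2 * ?D) * (b $ i) ^ (2 * d)"
        by (simp add: scale_def power_mult_distrib i power_int_power' mult_ac)
      then have "l powi (2 * ?D) = inverse ((b $ i) ^ (2 * d)) * (scale z l b $ i) ^ (2 * d)"
        using B(2)[OF that(2)] by simp
      also have "\<dots> \<le> max 0 R' * (scale z l b $ i) ^ (2 * d)"
        using R'[OF that(2)] by (intro mult_right_mono) auto
      also have "\<dots> \<le> max 0 R' * (1 + (\<Sum>i\<in>UNIV. (scale z l b $ i) ^ (2 * d)))"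
      proof (rule mult_left_mono)
        have "(scale z l b $ i) ^ (2 * d) \<le> (\<Sum>i\<in>UNIV. (scale z l b $ i) ^ (2 * d))"
          by (rule member_le_sum) auto
        then show "(scale z l b $ i) ^ (2 * d) \<le> 1 + (\<Sum>i\<in>UNIV. (scale z l b $ i) ^ (2 * d))"
          by linarith
      qed simp
      finally show ?thesis .
    qed
    then show ?thesis by (intro exI[of _ "max 0 R'"]) auto
  qed
  then obtain R' where R': "R' \<ge> 0" "\<And>l b. l \<ge> 1 \<Longrightarrow> b \<in> B \<Longrightarrow>
    l powi (2 * ?D) \<le> R' * (1 + (\<Sum>i\<in>UNIV. (scale z l b $ i) ^ (2 * d)))"
    by blast
  show ?thesis
  proof (intro exI[of _ "R\<^sup>2 * R'"] conjI ballI)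
    fix x assume "x \<in> T"
    then obtain l b where x: "x = scale z l b" "l \<ge> 1" "b \<in> B" using B(3) by blast
    have "R\<^sup>2 * l powi (2 * ?D) \<le> R\<^sup>2 * (R' * (1 + (\<Sum>i\<in>UNIV. (scale z l b $ i) ^ (2 * d))))"
      using R'(2)[OF x(2,3)] by (intro mult_left_mono) auto
    with up[OF x(2,3)] show "(rpoly_eval p x)\<^sup>2 \<le> R\<^sup>2 * R' * (1 + (\<Sum>i\<in>UNIV. (x $ i) ^ (2 * d)))"
      unfolding x(1) by (simp add: mult_ac)
  qed (use R' in simp)
qed

text \<open>Turns the analytic condition into a combinatorial one: it can be checked monomial by
  monomial, so \<open>B_deg d\<close> is spanned by monomials.\<close>

lemma B_deg_tentacles:
  fixes \<T> :: "(real ^ 'n::finite) set set"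
  assumes fin: "finite \<T>" and tent: "\<And>T. T \<in> \<T> \<Longrightarrow> standard_z_tentacle (\<zeta> T) T"
  shows "B_deg d (\<Union>\<T>) = {p. \<forall>m\<in>Poly_Mapping.keys p. (m, d) \<in> weight_cone (\<zeta> ` \<T>)}"
proof (intro set_eqI iffI)
  fix p assume "p \<in> B_deg d (\<Union>\<T>)"
  then show "p \<in> {p. \<forall>m\<in>Poly_Mapping.keys p. (m, d) \<in> weight_cone (\<zeta> ` \<T>)}"
    using weight_le_if_dominated[OF tent] by (fastforce simp: B_deg_def weight_cone_def)
next
  fix p :: "'n rpoly"
  assume p: "p \<in> {p. \<forall>m\<in>Poly_Mapping.keys p. (m, d) \<in> weight_cone (\<zeta> ` \<T>)}"
  let ?s = "\<lambda>x::real^'n. 1 + (\<Sum>i\<in>UNIV. (x $ i) ^ (2 * d))"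
  have "\<exists>C\<ge>0. \<forall>x\<in>T. (rpoly_eval p x)\<^sup>2 \<le> C * ?s x" if "T \<in> \<T>" for T
    using p that by (intro dominated_if_weight_le[OF tent]) (auto simp: weight_cone_def)
  then obtain C where C: "\<And>T. T \<in> \<T> \<Longrightarrow> C T \<ge> 0"
    "\<And>T x. T \<in> \<T> \<Longrightarrow> x \<in> T \<Longrightarrow> (rpoly_eval p x)\<^sup>2 \<le> C T * ?s x"
    by metis
  \<comment> \<open>The constants are nonnegative, so their sum works on all tentacles at
    once.\<close>
  define c where "c = sum C \<T>"
  define q :: "'n rpoly" where
    "q = Poly_Mapping.single 0 c
      + (\<Sum>i\<in>UNIV. Poly_Mapping.single (Poly_Mapping.single i (2 * d)) c)"
  have q: "rpoly_eval q x = c * ?s x" for x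
    by (simp add: q_def rpoly_eval_add rpoly_eval_sum rpoly_eval_single monom_eval_single
        sum_distrib_left algebra_simps)
  have "Poly_Mapping.keys q \<subseteq> {0} \<union> range (\<lambda>i. Poly_Mapping.single i (2 * d))"
    unfolding q_def
    by (rule order_trans[OF keys_add], rule Un_mono)
      (auto dest!: subsetD[OF keys_sum] split: if_splits)
  then have "(\<Sum>i\<in>UNIV. Poly_Mapping.lookup m i) \<le> 2 * d" if "m \<in> Poly_Mapping.keys q" for m
    using that by (auto simp: lookup_single when_def)
  then have "total_degree q \<le> 2 * d" by (auto simp: total_degree_def)
  moreover have "(rpoly_eval p x)\<^sup>2 \<le> rpoly_eval q x" if x: "x \<in> \<Union>\<T>" for x
  proof -
    obtain T where T: "T \<in> \<T>" "x \<in> T" using x by blast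
    have "C T \<le> c" unfolding c_def using T(1) fin C(1) by (intro member_le_sum) auto
    then have "C T * ?s x \<le> c * ?s x"
      by (intro mult_right_mono) (auto intro!: add_nonneg_nonneg sum_nonneg)
    then show ?thesis using C(2)[OF T] by (simp add: q)
  qed
  ultimately show "p \<in> B_deg d (\<Union>\<T>)" by (auto simp: B_deg_def)
qed

section \<open>Monoid algebras\<close>

lemma weight_cone_add:
  "x \<in> weight_cone Z \<Longrightarrow> y \<in> weight_cone Z \<Longrightarrow> x + y \<in> weight_cone Z"
  by (force simp: weight_cone_def weight_add algebra_simps plus_prod_def intro: add_mono)

text \<open>\<open>F\<close> consists of the coordinates and the slacks of the defining
  inequalities. If all of them grow from \<open>x\<close> to \<open>y\<close>, then
  \<open>y - x\<close> has nonnegative coordinates and slacks, hence lies in the cone.\<close>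

lemma weight_cone_finitely_generated:
  assumes "finite Z"
  shows "\<exists>G\<subseteq>weight_cone Z. finite G \<and>
    (\<forall>H. G \<subseteq> H \<longrightarrow> 0 \<in> H \<longrightarrow> (\<forall>x\<in>H. \<forall>y\<in>H. x + y \<in> H) \<longrightarrow> weight_cone Z \<subseteq> H)"
proof (rule finitely_generated_monoid)
  \<comment> \<open>On the cone the integer difference is nonnegative, so \<open>nat\<close> loses
    nothing.\<close>
  define slack :: "int ^ 'a \<Rightarrow> ('a \<Rightarrow>\<^sub>0 nat) \<times> nat \<Rightarrow> nat" where
    "slack = (\<lambda>z (m, d). nat (int d * weight_bound z - weight z m))"
  define F where "F = insert snd (range (\<lambda>i (m, d). Poly_Mapping.lookup m i) \<union> slack ` Z)"
  show "finite F" using assms by (simp add: F_def)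
  show "\<exists>w\<in>weight_cone Z. y = x + w"
    if "x \<in> weight_cone Z" "y \<in> weight_cone Z" "\<forall>f\<in>F. f x \<le> f y" for x y
  proof -
    obtain m d m' d' where xy: "x = (m, d)" "y = (m', d')" by fastforce
    have d: "d \<le> d'" and m: "\<forall>i. Poly_Mapping.lookup m i \<le> Poly_Mapping.lookup m' i"
      and sl: "\<And>z. z \<in> Z \<Longrightarrow> slack z x \<le> slack z y"
      using that(3) xy by (simp_all add: F_def ball_Un)
    \<comment> \<open>The truncated subtraction is exact because \<open>m\<close> is componentwise
      below \<open>m'\<close>.\<close>
    have m': "m' = m + (m' - m)"
      using m by (intro poly_mapping_eqI) (simp add: lookup_add lookup_minus)
    have "weight z (m' - m) \<le> int (d' - d) * weight_bound z" if z: "z \<in> Z" for z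
    proof -
      have "weight z m' = weight z m + weight z (m' - m)"
        by (subst m') (rule weight_add)
      moreover have "int d * weight_bound z - weight z m \<le> int d' * weight_bound z - weight z m'"
        using sl[OF z] \<open>x \<in> weight_cone Z\<close> \<open>y \<in> weight_cone Z\<close> z
        by (simp add: slack_def xy weight_cone_def nat_le_eq_zle)
      ultimately show ?thesis using d by (simp add: of_nat_diff algebra_simps)
    qed
    then have "(m' - m, d' - d) \<in> weight_cone Z" by (simp add: weight_cone_def)
    moreover have "y = x + (m' - m, d' - d)" using m' d xy by (simp add: plus_prod_def)
    ultimately show ?thesis by blast
  qed
  let ?size = "\<lambda>(m :: 'a \<Rightarrow>\<^sub>0 nat, d). d + (\<Sum>i\<in>UNIV. Poly_Mapping.lookup m i)"
  show "?size (x + y) = ?size x + ?size y" for x y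
    by (simp add: case_prod_beta lookup_add sum.distrib)
  show "0 < ?size x" if "x \<noteq> 0" for x
    using that by (cases x) (auto simp: zero_prod_def poly_mapping_eq_iff fun_eq_iff)
qed

section \<open>Real subalgebras generated by monomials\<close>

lemma real_subalgebra_hull: "real_subalgebra (real_subalgebra hull G)"
  by (rule hull_in) (auto simp: real_subalgebra_def)

text \<open>Zero arises as the scalar multiple of 1 by 0.\<close>

lemma real_subalgebra_zero: "real_subalgebra A \<Longrightarrow> 0 \<in> A"
  unfolding real_subalgebra_def rpoly_const_def by (metis single_zero smult_0_left)

lemma real_subalgebra_sum:
  "real_subalgebra A \<Longrightarrow> (\<And>i. i \<in> I \<Longrightarrow> f i \<in> A) \<Longrightarrow> sum f I \<in> A"
  by (induction I rule: infinite_finite_induct)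
    (auto simp: real_subalgebra_zero, auto simp: real_subalgebra_def)

lemma poly_mapping_sum_single:
  fixes p :: "'a \<Rightarrow>\<^sub>0 'b::comm_monoid_add"
  shows "p = (\<Sum>m\<in>Poly_Mapping.keys p. Poly_Mapping.single m (Poly_Mapping.lookup p m))"
  by (intro poly_mapping_eqI)
    (auto simp: lookup_sum lookup_single when_def in_keys_iff)

text \<open>Splits each coefficient in \<real>[x] further into monomials, so that only real scalars
  remain, as \<open>real_subalgebra\<close> demands.\<close>

lemma rpoly_poly_expansion:
  "(P :: 'n::finite rpoly poly) =
    (\<Sum>d\<le>degree P. \<Sum>m\<in>Poly_Mapping.keys (coeff P d).
      smult (rpoly_const (Poly_Mapping.lookup (coeff P d) m))
        (Polynomial.monom (Poly_Mapping.single m 1) d))"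
proof -
  have "(\<Sum>m\<in>Poly_Mapping.keys (coeff P d).
      smult (rpoly_const (Poly_Mapping.lookup (coeff P d) m))
        (Polynomial.monom (Poly_Mapping.single m 1) d)) = Polynomial.monom (coeff P d) d" for d
    by (subst (3) poly_mapping_sum_single)
      (simp add: smult_monom rpoly_const_def mult_single monom_sum)
  then show ?thesis by (simp add: poly_as_sum_of_monoms)
qed

text \<open>The set in question is the monoid algebra of \<open>M\<close>: \<open>X\<close> turns
  sums in \<open>M\<close> into products of monomials, so monoid generators yield algebra
  generators.\<close>

lemma finitely_generated_if_monoid:
  fixes M :: "(('n::finite \<Rightarrow>\<^sub>0 nat) \<times> nat) set"
  assumes zero: "0 \<in> M" and add: "\<And>x y. x \<in> M \<Longrightarrow> y \<in> M \<Longrightarrow> x + y \<in> M"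
    and G: "G \<subseteq> M" "finite G"
    and gen: "\<And>H. G \<subseteq> H \<Longrightarrow> 0 \<in> H \<Longrightarrow> (\<And>x y. x \<in> H \<Longrightarrow> y \<in> H \<Longrightarrow> x + y \<in> H) \<Longrightarrow> M \<subseteq> H"
  shows "finitely_generated_real_algebra
    {P :: 'n rpoly poly. \<forall>d. \<forall>m\<in>Poly_Mapping.keys (coeff P d). (m, d) \<in> M}"
    (is "finitely_generated_real_algebra ?A")
proof -
  define X :: "('n \<Rightarrow>\<^sub>0 nat) \<times> nat \<Rightarrow> 'n rpoly poly"
    where "X = (\<lambda>(m, d). Polynomial.monom (Poly_Mapping.single m 1) d)"
  let ?hull = "real_subalgebra hull (X ` G)"
  have X0: "X 0 = 1" by (simp add: X_def zero_prod_def)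
  have X_add: "X (x + y) = X x * X y" for x y
    by (simp add: X_def case_prod_beta mult_monom mult_single)
  have "real_subalgebra ?A"
    unfolding real_subalgebra_def
  proof (intro conjI ballI allI)
    show "1 \<in> ?A" using zero by (auto simp: coeff_1 zero_prod_def)
  next
    fix f g assume "f \<in> ?A" "g \<in> ?A"
    then show "f + g \<in> ?A" using keys_add by fastforce
  next
    fix f g assume fg: "f \<in> ?A" "g \<in> ?A"
    have "(m, d) \<in> M" if m: "m \<in> Poly_Mapping.keys (coeff (f * g) d)" for m d
    proof -
      obtain i where i: "i \<le> d" "m \<in> Poly_Mapping.keys (coeff f i * coeff g (d - i))"
        using m keys_sum[of "\<lambda>i. coeff f i * coeff g (d - i)" "{..d}"] by (auto simp: coeff_mult)
      then obtain u v where "m = u + v" "u \<in> Poly_Mapping.keys (coeff f i)"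
        "v \<in> Poly_Mapping.keys (coeff g (d - i))"
        using keys_mult by blast
      then show ?thesis using fg i(1) add[of "(u, i)" "(v, d - i)"] by (simp add: plus_prod_def)
    qed
    then show "f * g \<in> ?A" by simp
  next
    fix c f assume f: "f \<in> ?A"
    have "Poly_Mapping.keys (rpoly_const c * p) \<subseteq> Poly_Mapping.keys p" for p :: "'n rpoly"
      using keys_mult[of "rpoly_const c" p] by (auto simp: rpoly_const_def split: if_splits)
    then show "smult (rpoly_const c) f \<in> ?A" using f by fastforce
  qed
  moreover have "X ` G \<subseteq> ?A"
    using G(1) by (auto simp: X_def split: if_splits)
  ultimately have "?hull \<subseteq> ?A" by (intro hull_minimal)
  moreover have "?A \<subseteq> ?hull"
  proof
    fix P assume P: "P \<in> ?A"
    have hull: "real_subalgebra ?hull" by (rule real_subalgebra_hull)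
    \<comment> \<open>The elements whose monomial lies in the hull form a submonoid containing
      \<open>G\<close>.\<close>
    have "M \<subseteq> {x. X x \<in> ?hull}"
    proof (rule gen)
      show "G \<subseteq> {x. X x \<in> ?hull}" by (auto intro: hull_inc)
    qed (use hull X0 in \<open>auto simp: X_add real_subalgebra_def\<close>)
    then have "Polynomial.monom (Poly_Mapping.single m 1) d \<in> ?hull" if "(m, d) \<in> M" for m d
      using that by (auto simp: X_def)
    then show "P \<in> ?hull"
      using P hull
      by (subst rpoly_poly_expansion) (intro real_subalgebra_sum; simp add: real_subalgebra_def)
  qed
  ultimately show ?thesis
    unfolding finitely_generated_real_algebra_def using G(2) by (intro exI[of _ "X ` G"]) auto
qed

theorem theorem2p3:
  fixes S :: "(real ^ 'n::finite) set"
    and \<T> :: "(real ^ 'n) set set"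
  assumes "finite \<T>"
    and "\<And>T. T \<in> \<T> \<Longrightarrow> standard_tentacle T"
    and "S = \<Union>\<T>"
  shows "finitely_generated_real_algebra (B_graded S)"
proof -
  \<comment> \<open>Chooses one direction for each tentacle.\<close>
  obtain \<zeta> where \<zeta>: "\<And>T. T \<in> \<T> \<Longrightarrow> standard_z_tentacle (\<zeta> T) T"
    using assms(2) unfolding standard_tentacle_def by metis
  let ?M = "weight_cone (\<zeta> ` \<T>)"
  obtain G where "G \<subseteq> ?M" "finite G" and
    gen: "\<forall>H. G \<subseteq> H \<longrightarrow> 0 \<in> H \<longrightarrow> (\<forall>x\<in>H. \<forall>y\<in>H. x + y \<in> H) \<longrightarrow> ?M \<subseteq> H"
    using weight_cone_finitely_generated[of "\<zeta> ` \<T>"] assms(1) by blast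
  have "finitely_generated_real_algebra
      {P :: 'n rpoly poly. \<forall>d. \<forall>m\<in>Poly_Mapping.keys (coeff P d). (m, d) \<in> ?M}"
  proof (rule finitely_generated_if_monoid)
    show "0 \<in> ?M" by (simp add: weight_cone_def zero_prod_def)
  qed (use weight_cone_add \<open>G \<subseteq> ?M\<close> \<open>finite G\<close> gen in blast)+
  \<comment> \<open>Degree by degree, the coefficient condition of \<open>B_graded\<close> is
    membership of all \<open>(m, d)\<close> in the cone.\<close>
  then show ?thesis
    by (simp add: B_graded_def assms(3) B_deg_tentacles[where \<zeta> = \<zeta>, OF assms(1) \<zeta>])
qed

end
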